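(* Let $d,m,k\in\mathbb{N}$ with $1\le k\le m$, put $I=\{1,\ldots,m\}$ and $J=\{1,\ldots,k\}$, let $A=\{a_1,\ldots,a_m\}$ be a set of $m$ distinct points of $\mathbb{R}^d$, and let $F\subset\mathbb{R}^d$ be a nonempty compact convex set with $0\in\operatorname{int}(F)$. Let $\bar x=(\bar x_1,\ldots,\bar x_k)\in\mathbb{R}^{dk}$ and assume that $J_i(\bar x)$ is a singleton for every $i\in I$. Assume further that for every $\ell\in J$, if $A[\bar x_\ell]$ is nonempty, then $\bar x_\ell$ is a global optimal solution of the 1-center problem defined by the data set $A[\bar x_\ell]$. Then $\bar x$ is a local optimal solution to the problem $$\min\Big\{f_k^F(x)=\max_{i\in I}\Big(\min_{\ell\in J}\rho_F(x_\ell-a_i)\Big)\ \Big|\ x=(x_1,\ldots,x_k)\in\mathbb{R}^{dk}\Big\}.$$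
   Context: The Minkowski gauge function $\rho_F:\mathbb{R}^d\to[0,\infty)$ of $F$ is $\rho_F(x)=\inf\{t\ge 0\mid x\in tF\}$. For $x=(x_1,\ldots,x_k)\in\mathbb{R}^{dk}=(\mathbb{R}^d)^k$: - The attraction set of the component $x_\ell$ of $x$ is $A[x_\ell]=\{a_i\in A\mid \rho_F(x_\ell-a_i)=\min_{r\in J}\rho_F(x_r-a_i)\}$ (it depends on the whole system $x$ and the index $\ell$). - For $(i,\ell)\in I\times J$, $h_{i,\ell}(x)=\sum_{r\in J\setminus\{\ell\}}\rho_F(x_r-a_i)$, $h_i(x)=\max_{\ell\in J}h_{i,\ell}(x)$, and $J_i(x)=\{\ell\in J\mid h_{i,\ell}(x)=h_i(x)\}$. The 1-center problem defined by a nonempty finite data set $D\subset\mathbb{R}^d$ is $\min\{\max_{a\in D}\rho_F(y-a)\mid y\in\mathbb{R}^d\}$; a global optimal solution is a global minimizer. $\bar x=(\bar x_1,\ldots,\bar x_k)$ is a local optimal solution if there is $\varepsilon>0$ such that $f_k^F(\bar x)\le f_k^F(x)$ for every $x=(x_1,\ldots,x_k)\in\mathbb{R}^{dk}$ with $\|x_\ell-\bar x_\ell\|<\varepsilon$ for all $\ell\in J$, where $\|\cdot\|$ is the Euclidean norm. *)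

theory Defs
  imports "HOL-Analysis.Analysis"
begin

text \<open>
  A system \<open>x = (x\<^sub>1, \<dots>, x\<^sub>k)\<close> of \<open>k\<close> points of \<open>\<real>\<^sup>d\<close> is represented by a function
  \<open>x :: nat \<Rightarrow> real ^ 'd\<close> of which only the values at the indices in \<open>{1..k}\<close> are used;
  likewise the data points \<open>a\<^sub>1, \<dots>, a\<^sub>m\<close> are the values of \<open>a\<close> at the indices in \<open>{1..m}\<close>.
  The operators \<open>Min\<close> and \<open>Max\<close> are meaningful for \<open>1 \<le> k\<close> and \<open>1 \<le> m\<close>.
\<close>

definition minkowski_gauge :: "(real ^ 'd) set \<Rightarrow> real ^ 'd \<Rightarrow> real" where
  "minkowski_gauge F x = Inf {t. 0 \<le> t \<and> x \<in> (\<lambda>y. t *\<^sub>R y) ` F}"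

definition attraction_set ::
  "(real ^ 'd) set \<Rightarrow> nat \<Rightarrow> (nat \<Rightarrow> real ^ 'd) \<Rightarrow> nat \<Rightarrow> (nat \<Rightarrow> real ^ 'd) \<Rightarrow> nat \<Rightarrow> (real ^ 'd) set"
where
  "attraction_set F m a k x l =
     {a i | i. i \<in> {1..m} \<and>
        minkowski_gauge F (x l - a i) = Min ((\<lambda>r. minkowski_gauge F (x r - a i)) ` {1..k})}"

definition h_pair ::
  "(real ^ 'd) set \<Rightarrow> (nat \<Rightarrow> real ^ 'd) \<Rightarrow> nat \<Rightarrow> nat \<Rightarrow> nat \<Rightarrow> (nat \<Rightarrow> real ^ 'd) \<Rightarrow> real" where
  "h_pair F a k i l x = (\<Sum>r\<in>{1..k} - {l}. minkowski_gauge F (x r - a i))"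

definition h_max ::
  "(real ^ 'd) set \<Rightarrow> (nat \<Rightarrow> real ^ 'd) \<Rightarrow> nat \<Rightarrow> nat \<Rightarrow> (nat \<Rightarrow> real ^ 'd) \<Rightarrow> real" where
  "h_max F a k i x = Max ((\<lambda>l. h_pair F a k i l x) ` {1..k})"

definition active_indices ::
  "(real ^ 'd) set \<Rightarrow> (nat \<Rightarrow> real ^ 'd) \<Rightarrow> nat \<Rightarrow> nat \<Rightarrow> (nat \<Rightarrow> real ^ 'd) \<Rightarrow> nat set" where
  "active_indices F a k i x = {l \<in> {1..k}. h_pair F a k i l x = h_max F a k i x}"

definition one_center_objective :: "(real ^ 'd) set \<Rightarrow> (real ^ 'd) set \<Rightarrow> real ^ 'd \<Rightarrow> real" where
  "one_center_objective F D y = Max ((\<lambda>p. minkowski_gauge F (y - p)) ` D)"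

text \<open>Only meant for finite nonempty \<open>D\<close>.\<close>

definition one_center_solution :: "(real ^ 'd) set \<Rightarrow> (real ^ 'd) set \<Rightarrow> real ^ 'd \<Rightarrow> bool" where
  "one_center_solution F D y \<longleftrightarrow> (\<forall>z. one_center_objective F D y \<le> one_center_objective F D z)"

definition k_center_objective ::
  "(real ^ 'd) set \<Rightarrow> nat \<Rightarrow> (nat \<Rightarrow> real ^ 'd) \<Rightarrow> nat \<Rightarrow> (nat \<Rightarrow> real ^ 'd) \<Rightarrow> real" where
  "k_center_objective F m a k x =
     Max ((\<lambda>i. Min ((\<lambda>l. minkowski_gauge F (x l - a i)) ` {1..k})) ` {1..m})"

definition k_center_local_solution ::
  "(real ^ 'd) set \<Rightarrow> nat \<Rightarrow> (nat \<Rightarrow> real ^ 'd) \<Rightarrow> nat \<Rightarrow> (nat \<Rightarrow> real ^ 'd) \<Rightarrow> bool" where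
  "k_center_local_solution F m a k xbar \<longleftrightarrow>
     (\<exists>\<epsilon>>0. \<forall>x. (\<forall>l\<in>{1..k}. norm (x l - xbar l) < \<epsilon>) \<longrightarrow>
        k_center_objective F m a k xbar \<le> k_center_objective F m a k x)"

end

theory Submission
  imports Defs
begin

text \<open>
  Since \<open>h_pair\<close> is a constant minus one distance, \<open>J\<^sub>i(xbar)\<close> is the set of centers nearest to
  \<open>a\<^sub>i\<close>. If each data point has a unique nearest center, then by Lipschitz continuity of the gauge
  this center remains nearest under small perturbations. So near \<open>xbar\<close> the objective is bounded
  below by the 1-center objective of the cluster containing a worst-served data point, and this
  is minimal at \<open>xbar\<close> by assumption.
\<close>

lemma minkowski_gauge_leI:
  assumes "0 \<le> t" "x \<in> (\<lambda>y. t *\<^sub>R y) ` F"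
  shows "minkowski_gauge F x \<le> t"
  unfolding minkowski_gauge_def
  by (rule cInf_lower) (use assms in \<open>auto intro: bdd_belowI[of _ 0]\<close>)

text \<open>A ball of radius \<open>d\<close> around 0 lies in \<open>F\<close>, so
  \<open>C = 1 / d\<close> works. The membership form is recorded too: it shows that the infimum
  defining the gauge is over a nonempty set.\<close>

lemma minkowski_gauge_bound:
  assumes "0 \<in> interior F"
  obtains C where "C > 0" "\<And>x. minkowski_gauge F x \<le> C * norm x"
    "\<And>x. x \<in> (\<lambda>y. (C * norm x) *\<^sub>R y) ` F"
proof -
  obtain d where d: "d > 0" "cball 0 d \<subseteq> F"
    using assms by (meson mem_interior_cball)
  have mem: "x \<in> (\<lambda>y. (1 / d * norm x) *\<^sub>R y) ` F" for x
  proof (rule image_eqI)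
    \<comment> \<open>The witness is \<open>x\<close> rescaled to norm \<open>d\<close>; for
      \<open>x = 0\<close> it is 0, because division by zero yields 0.\<close>
    show "x = (1 / d * norm x) *\<^sub>R ((d / norm x) *\<^sub>R x)"
      using d by (cases "x = 0") auto
    have "(d / norm x) *\<^sub>R x \<in> cball 0 d"
      using d by (cases "x = 0") auto
    then show "(d / norm x) *\<^sub>R x \<in> F"
      using d by blast
  qed
  show ?thesis
  proof (rule that[of "1 / d"])
    show "minkowski_gauge F x \<le> 1 / d * norm x" for x
      by (rule minkowski_gauge_leI) (use d mem in auto)
  qed (use d mem in auto)
qed

text \<open>With \<open>x = s u\<close> and \<open>y = t v\<close>, the sum is \<open>s + t\<close>
  times the convex combination of \<open>u\<close> and \<open>v\<close> with weights
  \<open>s / (s + t)\<close> and \<open>t / (s + t)\<close>. If \<open>s + t = 0\<close>, both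
  points are 0.\<close>

lemma scaled_convex_sum:
  fixes F :: "'a::real_vector set"
  assumes "convex F" "0 \<le> s" "0 \<le> t"
    and "x \<in> (\<lambda>y. s *\<^sub>R y) ` F" "y \<in> (\<lambda>y. t *\<^sub>R y) ` F"
  shows "x + y \<in> (\<lambda>y. (s + t) *\<^sub>R y) ` F"
proof -
  obtain u v where uv: "u \<in> F" "v \<in> F" "x = s *\<^sub>R u" "y = t *\<^sub>R v"
    using assms by blast
  show ?thesis
  proof (cases "s + t = 0")
    case True
    then have "s = 0" "t = 0" using assms by auto
    with uv show ?thesis by auto
  next
    case False
    then have "s + t > 0" using assms by auto
    show ?thesis
    proof (rule image_eqI)
      show "x + y = (s + t) *\<^sub>R ((s / (s + t)) *\<^sub>R u + (t / (s + t)) *\<^sub>R v)"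
        using False uv by (simp add: scaleR_add_right)
      show "(s / (s + t)) *\<^sub>R u + (t / (s + t)) *\<^sub>R v \<in> F"
        by (rule convexD) (use assms uv \<open>s + t > 0\<close> in \<open>auto simp flip: add_divide_distrib\<close>)
    qed
  qed
qed

lemma minkowski_gauge_triangle:
  assumes "convex F" "0 \<in> interior F"
  shows "minkowski_gauge F (x + y) \<le> minkowski_gauge F x + minkowski_gauge F y"
proof -
  obtain C where C: "C > 0" "\<And>x. x \<in> (\<lambda>y. (C * norm x) *\<^sub>R y) ` F"
    using minkowski_gauge_bound[OF assms(2)] by metis
  define T where "T x = {t. 0 \<le> t \<and> x \<in> (\<lambda>y. t *\<^sub>R y) ` F}" for x
  have gauge: "minkowski_gauge F z = Inf (T z)" for z
    by (simp add: minkowski_gauge_def T_def)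
  have ne: "T z \<noteq> {}" for z
    using C(1) C(2)[of z] by (auto simp: T_def intro!: exI[of _ "C * norm z"])
  have sum: "minkowski_gauge F (x + y) \<le> s + t" if "s \<in> T x" "t \<in> T y" for s t
    by (rule minkowski_gauge_leI)
      (use that scaled_convex_sum[OF assms(1)] in \<open>auto simp: T_def\<close>)
  \<comment> \<open>The infimum is taken over \<open>s\<close> with \<open>t\<close> fixed, and
    afterwards over \<open>t\<close>.\<close>
  have "minkowski_gauge F (x + y) - t \<le> minkowski_gauge F x" if "t \<in> T y" for t
    unfolding gauge[of x] by (rule cInf_greatest[OF ne]) (use sum that in fastforce)
  then have "minkowski_gauge F (x + y) - minkowski_gauge F x \<le> minkowski_gauge F y"
    unfolding gauge[of y] by (intro cInf_greatest[OF ne]) fastforce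
  then show ?thesis by simp
qed

text \<open>Subadditivity for \<open>x = (x - y) + y\<close> bounds one difference. The gauge itself
  may be asymmetric, but the bounding norm is symmetric, so exchanging \<open>x\<close> and
  \<open>y\<close> bounds the other.\<close>

lemma minkowski_gauge_lipschitz:
  assumes "convex F" "0 \<in> interior F"
  obtains C where "C > 0"
    "\<And>x y. \<bar>minkowski_gauge F x - minkowski_gauge F y\<bar> \<le> C * norm (x - y)"
proof -
  obtain C where C: "C > 0" "\<And>x. minkowski_gauge F x \<le> C * norm x"
    using minkowski_gauge_bound[OF assms(2)] by metis
  have "minkowski_gauge F x - minkowski_gauge F y \<le> C * norm (x - y)" for x y
    using minkowski_gauge_triangle[OF assms, of "x - y" y] C(2)[of "x - y"] by simp
  then have "\<bar>minkowski_gauge F x - minkowski_gauge F y\<bar> \<le> C * norm (x - y)" for x y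
    by (metis abs_le_iff minus_diff_eq norm_minus_commute)
  with C(1) show ?thesis by (rule that)
qed

text \<open>Turns the singleton hypothesis into uniqueness of the nearest center: the total
  \<open>S\<close> does not depend on \<open>l\<close>, so maximizing \<open>h_pair\<close>
  minimizes the subtracted gauge.\<close>

lemma active_indices_eq_nearest:
  assumes "1 \<le> k"
  shows "active_indices F a k i x =
    {l \<in> {1..k}. \<forall>r\<in>{1..k}. minkowski_gauge F (x l - a i) \<le> minkowski_gauge F (x r - a i)}"
proof -
  define S where "S = (\<Sum>r\<in>{1..k}. minkowski_gauge F (x r - a i))"
  have h: "h_pair F a k i l x = S - minkowski_gauge F (x l - a i)" if "l \<in> {1..k}" for l
    unfolding h_pair_def S_def using that by (subst sum_diff1) auto
  have "h_pair F a k i l x = h_max F a k i x \<longleftrightarrow>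
      (\<forall>r\<in>{1..k}. h_pair F a k i r x \<le> h_pair F a k i l x)" if "l \<in> {1..k}" for l
    unfolding h_max_def
    by (subst eq_commute, subst Max_eq_iff) (use that in auto)
  then show ?thesis
    unfolding active_indices_def using h by auto
qed

text \<open>Both compared values move by at most \<open>C * \<epsilon>\<close>, so a gap exceeding
  \<open>2 * C * \<epsilon>\<close> cannot be closed. As there are finitely many gaps, one
  \<open>\<epsilon>\<close> serves them all.\<close>

lemma strict_argmin_stable:
  fixes g :: "'a::real_normed_vector \<Rightarrow> 'i \<Rightarrow> real"
  assumes "finite I" "finite J" "C > 0"
    and lip: "\<And>i x y. \<bar>g x i - g y i\<bar> \<le> C * norm (x - y)"
    and s: "\<And>i. i \<in> I \<Longrightarrow> s i \<in> J"
    and strict: "\<And>i r. \<lbrakk>i \<in> I; r \<in> J; r \<noteq> s i\<rbrakk> \<Longrightarrow> g (xbar (s i)) i < g (xbar r) i"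
  obtains \<epsilon> where "\<epsilon> > 0"
    "\<And>x i r. \<lbrakk>\<forall>l\<in>J. norm (x l - xbar l) < \<epsilon>; i \<in> I; r \<in> J\<rbrakk> \<Longrightarrow> g (x (s i)) i \<le> g (x r) i"
proof -
  have "\<forall>\<^sub>F e in at_right 0. r \<noteq> s i \<longrightarrow> 2 * C * e < g (xbar r) i - g (xbar (s i)) i"
    if "i \<in> I" "r \<in> J" for i r
  proof (cases "r = s i")
    case False
    have "((\<lambda>e. 2 * C * e) \<longlongrightarrow> 2 * C * 0) (at_right 0)"
      by (intro tendsto_intros)
    then have "\<forall>\<^sub>F e in at_right 0. 2 * C * e < g (xbar r) i - g (xbar (s i)) i"
      by (rule order_tendstoD) (use strict[OF that False] in simp)
    then show ?thesis by (simp add: False)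
  qed simp
  then have "\<forall>\<^sub>F e in at_right 0. \<forall>i\<in>I. \<forall>r\<in>J. r \<noteq> s i \<longrightarrow>
      2 * C * e < g (xbar r) i - g (xbar (s i)) i"
    using assms by (auto intro!: eventually_ball_finite)
  then have "\<forall>\<^sub>F e::real in at_right 0. e > 0 \<and> (\<forall>i\<in>I. \<forall>r\<in>J. r \<noteq> s i \<longrightarrow>
      2 * C * e < g (xbar r) i - g (xbar (s i)) i)"
    by (intro eventually_conj eventually_at_right_less)
  then obtain e where e: "e > 0"
    "\<And>i r. \<lbrakk>i \<in> I; r \<in> J; r \<noteq> s i\<rbrakk> \<Longrightarrow> 2 * C * e < g (xbar r) i - g (xbar (s i)) i"
    by (auto dest!: eventually_happens)
  show ?thesis
  proof (rule that[OF e(1)])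
    fix x i r
    assume near: "\<forall>l\<in>J. norm (x l - xbar l) < e" and i: "i \<in> I" and r: "r \<in> J"
    have close: "\<bar>g (x l) i - g (xbar l) i\<bar> \<le> C * e" if "l \<in> J" for l
    proof -
      have "C * norm (x l - xbar l) \<le> C * e"
        using near that \<open>C > 0\<close> by (intro mult_left_mono) auto
      with lip show ?thesis by (rule order_trans)
    qed
    show "g (x (s i)) i \<le> g (x r) i"
    proof (cases "r = s i")
      case False
      show ?thesis
        using close[OF r] close[OF s[OF i]] e(2)[OF i r False] by linarith
    qed simp
  qed
qed

theorem theorem3p4:
  fixes F :: "(real ^ 'd) set"
    and a :: "nat \<Rightarrow> real ^ 'd"
    and xbar :: "nat \<Rightarrow> real ^ 'd"
    and m k :: nat
  assumes "1 \<le> k" and "k \<le> m"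
    and "inj_on a {1..m}"
    and "F \<noteq> {}" and "compact F" and "convex F" and "0 \<in> interior F"
    and "\<forall>i\<in>{1..m}. is_singleton (active_indices F a k i xbar)"
    and "\<forall>l\<in>{1..k}. attraction_set F m a k xbar l \<noteq> {} \<longrightarrow>
           one_center_solution F (attraction_set F m a k xbar l) (xbar l)"
  shows "k_center_local_solution F m a k xbar"
proof -
  define \<rho> where "\<rho> y i = minkowski_gauge F (y - a i)" for y i
  obtain C where C: "C > 0"
    "\<And>x y. \<bar>minkowski_gauge F x - minkowski_gauge F y\<bar> \<le> C * norm (x - y)"
    using minkowski_gauge_lipschitz[OF \<open>convex F\<close> \<open>0 \<in> interior F\<close>] by metis
  have lip: "\<bar>\<rho> x i - \<rho> y i\<bar> \<le> C * norm (x - y)" for x y i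
    using C(2)[of "x - a i" "y - a i"] by (simp add: \<rho>_def)
  \<comment> \<open>\<open>s i\<close> is the index of the unique center nearest to
    \<open>a i\<close>.\<close>
  obtain s where s: "\<And>i. i \<in> {1..m} \<Longrightarrow> active_indices F a k i xbar = {s i}"
    using assms(8) unfolding is_singleton_def by metis
  have nearest: "{l \<in> {1..k}. \<forall>r\<in>{1..k}. \<rho> (xbar l) i \<le> \<rho> (xbar r) i} = {s i}"
    if "i \<in> {1..m}" for i
    using s[OF that] unfolding active_indices_eq_nearest[OF \<open>1 \<le> k\<close>] \<rho>_def .
  have s_mem: "s i \<in> {1..k}" and s_min: "\<And>r. r \<in> {1..k} \<Longrightarrow> \<rho> (xbar (s i)) i \<le> \<rho> (xbar r) i"
    if "i \<in> {1..m}" for i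
    using nearest[OF that] by blast+
  have s_strict: "\<rho> (xbar (s i)) i < \<rho> (xbar r) i"
    if i: "i \<in> {1..m}" and r: "r \<in> {1..k}" "r \<noteq> s i" for i r
  proof (rule ccontr)
    assume "\<not> ?thesis"
    \<comment> \<open>A tie would make \<open>r\<close> a second element of the singleton.\<close>
    then have "\<forall>q\<in>{1..k}. \<rho> (xbar r) i \<le> \<rho> (xbar q) i"
      using s_min[OF i] by (meson not_less order_trans)
    with r nearest[OF i] show False by blast
  qed
  obtain \<epsilon> where \<epsilon>: "\<epsilon> > 0" "\<And>x i r. \<lbrakk>\<forall>l\<in>{1..k}. norm (x l - xbar l) < \<epsilon>; i \<in> {1..m};
      r \<in> {1..k}\<rbrakk> \<Longrightarrow> \<rho> (x (s i)) i \<le> \<rho> (x r) i"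
    using strict_argmin_stable[where g = \<rho> and s = s and xbar = xbar,
        OF finite_atLeastAtMost finite_atLeastAtMost C(1) lip s_mem s_strict]
    by blast
  define near where "near x \<longleftrightarrow> (\<forall>l\<in>{1..k}. norm (x l - xbar l) < \<epsilon>)" for x
  have near_xbar: "near xbar"
    using \<epsilon>(1) by (simp add: near_def)
  \<comment> \<open>Near \<open>xbar\<close> the assignment \<open>s\<close> of data points to
    centers stays valid, so the inner minimum disappears from the objective.\<close>
  have Min_eq: "Min ((\<lambda>l. \<rho> (x l) i) ` {1..k}) = \<rho> (x (s i)) i"
    if "near x" "i \<in> {1..m}" for x i
    by (rule Min_eqI) (use that \<epsilon>(2) s_mem near_def in auto)
  have obj: "k_center_objective F m a k x = Max ((\<lambda>i. \<rho> (x (s i)) i) ` {1..m})"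
    if "near x" for x
    unfolding k_center_objective_def \<rho>_def[symmetric]
    by (simp only: Min_eq[OF that] cong: image_cong)
  \<comment> \<open>The attraction sets at \<open>xbar\<close> are the clusters of \<open>s\<close>;
    strictness keeps a point from lying in two of them.\<close>
  have attr: "attraction_set F m a k xbar l = a ` {i \<in> {1..m}. s i = l}" if l: "l \<in> {1..k}" for l
  proof -
    have "\<rho> (xbar l) i = \<rho> (xbar (s i)) i \<longleftrightarrow> s i = l" if "i \<in> {1..m}" for i
      using s_strict[OF that l] by (cases "s i = l") auto
    then show ?thesis
      unfolding attraction_set_def \<rho>_def[symmetric]
      using Min_eq[OF near_xbar] by auto
  qed
  \<comment> \<open>Picks a worst-served data point \<open>a j\<close>; its cluster has index set
    \<open>D\<close>.\<close>
  have "Max ((\<lambda>i. \<rho> (xbar (s i)) i) ` {1..m}) \<in> (\<lambda>i. \<rho> (xbar (s i)) i) ` {1..m}"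
    using \<open>1 \<le> k\<close> \<open>k \<le> m\<close> by (intro Max_in) auto
  then obtain j where j: "j \<in> {1..m}" "k_center_objective F m a k xbar = \<rho> (xbar (s j)) j"
    using obj[OF near_xbar] by auto
  define D where "D = {i \<in> {1..m}. s i = s j}"
  have D: "j \<in> D" "finite D" "D \<subseteq> {1..m}" and sD: "\<And>i. i \<in> D \<Longrightarrow> s i = s j"
    using j by (auto simp: D_def)
  have one: "one_center_objective F (a ` D) y = Max (\<rho> y ` D)" for y
    by (simp add: one_center_objective_def \<rho>_def image_image)
  \<comment> \<open>The cluster contains \<open>a j\<close>, so it is nonempty and the 1-center
    assumption applies.\<close>
  have opt: "one_center_solution F (a ` D) (xbar (s j))"
    using assms(9)[rule_format, OF s_mem[OF j(1)]] D(1)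
    unfolding attr[OF s_mem[OF j(1)]] D_def[symmetric] by blast
  have "k_center_objective F m a k xbar \<le> k_center_objective F m a k x" if "near x" for x
  proof -
    have "k_center_objective F m a k xbar \<le> Max (\<rho> (xbar (s j)) ` D)"
      unfolding j(2) using D by (intro Max_ge) auto
    \<comment> \<open>The moved center \<open>x (s j)\<close> is a competitor in the 1-center
      problem of the cluster.\<close>
    also have "\<dots> \<le> Max (\<rho> (x (s j)) ` D)"
      using opt by (simp add: one_center_solution_def one)
    also have "\<rho> (x (s j)) ` D = (\<lambda>i. \<rho> (x (s i)) i) ` D"
      using sD by (auto intro!: image_cong)
    also have "Max \<dots> \<le> Max ((\<lambda>i. \<rho> (x (s i)) i) ` {1..m})"
      using D by (intro Max_mono) auto
    also have "\<dots> = k_center_objective F m a k x"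
      using obj[OF that] by simp
    finally show ?thesis .
  qed
  then show ?thesis
    unfolding k_center_local_solution_def near_def using \<epsilon>(1) by blast
qed

end
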